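(* The best-in-class error is achieved by some $h^*\in\mathcal{H}$ and the minimizability gap is null, $\mathcal{M}(\mathcal{H})=0$, if and only if there exists $h^*\in\mathcal{H}$ such that $$\mathbb{E}_y[\ell(h^*(x),y)\mid x]=\inf_{\alpha\in A}\mathbb{E}_y[\ell(\alpha,y)\mid x]\quad\text{a.s. over }\mathcal{X}.$$ If further $\alpha\mapsto\mathbb{E}_y[\ell(\alpha,y)\mid x]$ is injective and $\inf_{\alpha\in A}\mathbb{E}_y[\ell(\alpha,y)\mid x]=\mathbb{E}_y[\ell(\alpha^*(x),y)\mid x]$, then the condition is equivalent to $h^*(x)=\alpha^*(x)$ a.s. for $x\in\mathcal{X}$. Furthermore, the minimizability gap is bounded by $\epsilon$, $\mathcal{M}(\mathcal{H})\le\epsilon$, if and only if there exists $h^*\in\mathcal{H}$ such that $$\mathbb{E}_x\left[\mathbb{E}_y[\ell(h^*(x),y)\mid x]-\inf_{\alpha\in A}\mathbb{E}_y[\ell(\alpha,y)\mid x]\right]\le\epsilon.$$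
   Context: Multi-class classification: input space $\mathcal{X}$, label space $[n]=\{1,\ldots,n\}$, $\mathcal{D}$ a distribution over $\mathcal{X}\times[n]$; $\mathcal{H}$ is a family of measurable functions $h\colon\mathcal{X}\times[n]\to\mathbb{R}$, and $h(x)=[h(x,1),\ldots,h(x,n)]\in\mathbb{R}^n$ denotes the score vector of $h$ at $x$. The surrogate loss of $h$ at $(x,y)$ is $\ell(h(x),y)$, with $\ell\colon\mathbb{R}^n\times[n]\to\mathbb{R}_+$ measurable. It is assumed that the set $A=\{h(x)\colon h\in\mathcal{H}\}\subseteq\mathbb{R}^n$ does not depend on $x\in\mathcal{X}$. $\mathbb{E}_y[\,\cdot\mid x]$ is the expectation under the conditional distribution of the label given $x$, and $\mathbb{E}_x$ is the expectation over the marginal distribution of $x$. $\alpha^*(x)$ denotes the minimizer over $A$ of the conditional error $\alpha\mapsto\mathbb{E}_y[\ell(\alpha,y)\mid x]$. The best-in-class error is $\inf_{h\in\mathcal{H}}\mathbb{E}_{(x,y)\sim\mathcal{D}}[\ell(h(x),y)]$, and it is achieved by $h^*$ if $\mathbb{E}_{(x,y)\sim\mathcal{D}}[\ell(h^*(x),y)]$ equals it. The minimizability gap is $\mathcal{M}(\mathcal{H})=\inf_{h\in\mathcal{H}}\mathbb{E}_{(x,y)\sim\mathcal{D}}[\ell(h(x),y)]-\mathbb{E}_x\left[\inf_{h\in\mathcal{H}}\mathbb{E}_y[\ell(h(x),y)\mid x]\right]$.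
   Formalization: The last equivalence (gap at most ε) is stated when the best-in-class error is achieved or the gap differs from ε, since it fails otherwise; the expected pointwise infimum in the gap is assumed finite so that the gap is defined. *)

theory Defs
  imports "HOL-Probability.Probability"
begin

text \<open>
  The label space \<open>[n]\<close> is a finite type \<open>'n\<close>, so that \<open>n = CARD('n)\<close> and score vectors live in
  \<open>real ^ 'n\<close>. The input space is a measurable space \<open>X\<close>, given as a measure of which only the
  underlying set and sigma-algebra matter.
\<close>

definition score :: "('a \<times> 'n::finite \<Rightarrow> real) \<Rightarrow> 'a \<Rightarrow> real ^ 'n" where
  "score h x = (\<chi> y. h (x, y))"

text \<open>
  Expectations of nonnegative functions are taken in \<open>[0, \<infinity>]\<close>, since the expected loss of a
  hypothesis may be infinite (a Bochner integral would then be \<open>0\<close>). The value is an \<open>ereal\<close> rather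
  than an \<open>ennreal\<close> so that differences of expectations are not truncated at \<open>0\<close>. The definition is
  meant for nonnegative \<open>f\<close> only.
\<close>

definition nn_expectation :: "'b measure \<Rightarrow> ('b \<Rightarrow> real) \<Rightarrow> ereal" where
  "nn_expectation M f = enn2ereal (\<integral>\<^sup>+ z. ennreal (f z) \<partial>M)"

definition marginal :: "'a measure \<Rightarrow> ('a \<times> 'n) measure \<Rightarrow> 'a measure" where
  "marginal X D = distr D X fst"

text \<open>
  \<open>K\<close> is a (version of the) conditional distribution of the label given the input: a Markov kernel
  that disintegrates \<open>D\<close>. As there are finitely many labels, it suffices to consider single labels.
\<close>

definition is_cond_label_dist ::
    "'a measure \<Rightarrow> ('a \<times> 'n::finite) measure \<Rightarrow> ('a \<Rightarrow> 'n pmf) \<Rightarrow> bool" where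
  "is_cond_label_dist X D K \<longleftrightarrow>
     (\<forall>y. (\<lambda>x. pmf (K x) y) \<in> borel_measurable X) \<and>
     (\<forall>B\<in>sets X. \<forall>y.
        emeasure D (B \<times> {y}) = (\<integral>\<^sup>+ x\<in>B. ennreal (pmf (K x) y) \<partial>marginal X D))"

definition gen_error ::
    "('a \<times> 'n::finite) measure \<Rightarrow> (real ^ 'n \<Rightarrow> 'n \<Rightarrow> real) \<Rightarrow> ('a \<times> 'n \<Rightarrow> real) \<Rightarrow> ereal" where
  "gen_error D loss h = nn_expectation D (\<lambda>(x, y). loss (score h x) y)"

definition cond_error ::
    "('a \<Rightarrow> 'n::finite pmf) \<Rightarrow> (real ^ 'n \<Rightarrow> 'n \<Rightarrow> real) \<Rightarrow> real ^ 'n \<Rightarrow> 'a \<Rightarrow> real" where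
  "cond_error K loss \<alpha> x = measure_pmf.expectation (K x) (\<lambda>y. loss \<alpha> y)"

definition best_in_class_error ::
    "('a \<times> 'n::finite) measure \<Rightarrow> (real ^ 'n \<Rightarrow> 'n \<Rightarrow> real) \<Rightarrow> ('a \<times> 'n \<Rightarrow> real) set \<Rightarrow> ereal" where
  "best_in_class_error D loss H = (INF h\<in>H. gen_error D loss h)"

definition best_in_class_achieved ::
    "('a \<times> 'n::finite) measure \<Rightarrow> (real ^ 'n \<Rightarrow> 'n \<Rightarrow> real) \<Rightarrow> ('a \<times> 'n \<Rightarrow> real) set \<Rightarrow> bool" where
  "best_in_class_achieved D loss H \<longleftrightarrow> (\<exists>h\<in>H. gen_error D loss h = best_in_class_error D loss H)"

text \<open>
  The difference below is meaningful only when the subtrahend is finite; in \<open>ereal\<close>,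
  \<open>\<infinity> - \<infinity> = \<infinity>\<close>.
\<close>

definition minimizability_gap ::
    "'a measure \<Rightarrow> ('a \<times> 'n::finite) measure \<Rightarrow> ('a \<Rightarrow> 'n pmf) \<Rightarrow>
     (real ^ 'n \<Rightarrow> 'n \<Rightarrow> real) \<Rightarrow> ('a \<times> 'n \<Rightarrow> real) set \<Rightarrow> ereal" where
  "minimizability_gap X D K loss H =
     best_in_class_error D loss H -
     nn_expectation (marginal X D) (\<lambda>x. INF h\<in>H. cond_error K loss (score h x) x)"

end

theory Submission
  imports Defs
begin

text \<open>
  Disintegrating \<open>D\<close> into its input marginal and \<open>K\<close> gives, for every \<open>h\<close> in \<open>H\<close>, that the
  generalization error of \<open>h\<close> is the expected pointwise infimum of the conditional error plus the
  expected excess conditional error of \<open>h\<close>. Hence the minimizability gap is the infimum over \<open>H\<close> of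
  the expected excess, and a nonnegative function has expectation \<open>0\<close> iff it vanishes almost surely.
  The pointwise infimum is measurable although \<open>A\<close> may be uncountable: the conditional error depends
  on \<open>\<alpha>\<close> only through its loss vector, on which it is continuous, so a countable set of \<open>\<alpha>\<close> whose
  loss vectors are dense in all of them yields the same infimum.
\<close>

section \<open>Expectations of nonnegative functions with values in the extended reals\<close>

lemma nn_expectation_nonneg: "0 \<le> nn_expectation M f"
  by (simp add: nn_expectation_def)

lemma nn_expectation_cong:
  assumes "\<And>x. x \<in> space M \<Longrightarrow> f x = g x"
  shows "nn_expectation M f = nn_expectation M g"
  unfolding nn_expectation_def using assms by (simp cong: nn_integral_cong)

lemma nn_expectation_add:
  assumes "f \<in> borel_measurable M" "g \<in> borel_measurable M"
    and "\<And>x. x \<in> space M \<Longrightarrow> 0 \<le> f x" "\<And>x. x \<in> space M \<Longrightarrow> 0 \<le> g x"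
  shows "nn_expectation M (\<lambda>x. f x + g x) = nn_expectation M f + nn_expectation M g"
proof -
  have "(\<integral>\<^sup>+ x. ennreal (f x + g x) \<partial>M) = (\<integral>\<^sup>+ x. ennreal (f x) + ennreal (g x) \<partial>M)"
    by (intro nn_integral_cong) (simp add: assms)
  also have "\<dots> = (\<integral>\<^sup>+ x. ennreal (f x) \<partial>M) + (\<integral>\<^sup>+ x. ennreal (g x) \<partial>M)"
    using assms by (intro nn_integral_add) auto
  finally show ?thesis
    by (simp add: nn_expectation_def plus_ennreal.rep_eq)
qed

lemma nn_expectation_eq_0_iff:
  assumes "f \<in> borel_measurable M" and "\<And>x. x \<in> space M \<Longrightarrow> 0 \<le> f x"
  shows "nn_expectation M f = 0 \<longleftrightarrow> (AE x in M. f x = 0)"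
proof -
  have "nn_expectation M f = 0 \<longleftrightarrow> (\<integral>\<^sup>+ x. ennreal (f x) \<partial>M) = 0"
    by (metis enn2ereal_inject nn_expectation_def zero_ennreal.rep_eq)
  also have "\<dots> \<longleftrightarrow> (AE x in M. ennreal (f x) = 0)"
    using assms(1) by (intro nn_integral_0_iff_AE) auto
  also have "\<dots> \<longleftrightarrow> (AE x in M. f x = 0)"
    using assms(2) by (intro AE_cong) (auto simp: ennreal_eq_0_iff intro: antisym)
  finally show ?thesis .
qed

section \<open>The conditional error and its infimum over score vectors\<close>

lemma cond_error_sum: "cond_error K loss \<alpha> x = (\<Sum>y\<in>UNIV. loss \<alpha> y * pmf (K x) y)"
  unfolding cond_error_def by (rule integral_measure_pmf_real) auto

lemma cond_error_nonneg:
  assumes "\<And>\<alpha> y. 0 \<le> loss \<alpha> y"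
  shows "0 \<le> cond_error K loss \<alpha> x"
  using assms by (auto simp: cond_error_sum intro!: sum_nonneg)

text \<open>The infimum is taken in the reals, where \<open>cINF_lower\<close> and
  \<open>cINF_superset_mono\<close> call for a lower bound; nonnegativity of the loss supplies
  0.\<close>

lemma bdd_below_cond_error:
  assumes "\<And>\<alpha> y. 0 \<le> loss \<alpha> y"
  shows "bdd_below ((\<lambda>\<alpha>. cond_error K loss \<alpha> x) ` A)"
  using cond_error_nonneg[of loss K, OF assms] by (auto intro!: bdd_belowI)

text \<open>One \<open>C\<close> serves all \<open>x\<close> at once, because the loss vectors do
  not depend on \<open>x\<close>; this uniformity is what makes the infimum measurable in
  \<open>x\<close>.\<close>

lemma INF_cond_error_countable:
  fixes K :: "'a \<Rightarrow> 'n::finite pmf" and A :: "(real ^ 'n) set"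
  assumes "\<And>\<alpha> y. 0 \<le> loss \<alpha> y"
  obtains C where "countable C" and "C \<subseteq> A"
    and "\<And>x. (INF \<alpha>\<in>A. cond_error K loss \<alpha> x) = (INF \<alpha>\<in>C. cond_error K loss \<alpha> x)"
proof (cases "A = {}")
  case True
  then show ?thesis using that[of "{}"] by simp
next
  case False
  define L :: "real ^ 'n \<Rightarrow> real ^ 'n" where "L \<alpha> = (\<chi> y. loss \<alpha> y)" for \<alpha>
  define E where "E x v = (\<Sum>y\<in>UNIV. v $ y * pmf (K x) y)" for x and v :: "real ^ 'n"
  have E_L: "cond_error K loss \<alpha> x = E x (L \<alpha>)" for \<alpha> x
    by (simp add: cond_error_sum E_def L_def)
  \<comment> \<open>Density is arranged among the loss vectors rather than in \<open>A\<close>: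
    \<open>loss\<close> may be discontinuous in the score vector, so approximating a score vector
    says nothing about its loss.\<close>
  obtain T where T: "countable T" "T \<subseteq> L ` A" "L ` A \<subseteq> closure T"
    by (rule separable[of "L ` A"])
  obtain C where C: "countable C" "C \<subseteq> A" "T = L ` C"
    using T(1,2) by (metis countable_subset_image)
  have C_ne: "C \<noteq> {}"
    using False T(3) C(3) by auto
  have "(INF \<alpha>\<in>A. cond_error K loss \<alpha> x) = (INF \<alpha>\<in>C. cond_error K loss \<alpha> x)" for x
  proof (rule antisym)
    show "(INF \<alpha>\<in>A. cond_error K loss \<alpha> x) \<le> (INF \<alpha>\<in>C. cond_error K loss \<alpha> x)"
      using C_ne C(2) bdd_below_cond_error[of loss K x A, OF assms] by (intro cINF_superset_mono) auto
    \<comment> \<open>Having \<open>E x v\<close> at least the infimum over \<open>C\<close> is a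
      closed condition on \<open>v\<close>. It holds on \<open>T\<close>, hence on the closure of
      \<open>T\<close>, which contains every loss vector from \<open>A\<close>.\<close>
    let ?S = "{v. (INF \<alpha>\<in>C. cond_error K loss \<alpha> x) \<le> E x v}"
    have "closed ?S"
      unfolding E_def by (intro closed_Collect_le continuous_intros)
    moreover have "T \<subseteq> ?S"
      unfolding C(3)
      using cINF_lower[OF bdd_below_cond_error[of loss K x C, OF assms]] by (auto simp: E_L)
    ultimately have "closure T \<subseteq> ?S"
      by (intro closure_minimal)
    then show "(INF \<alpha>\<in>C. cond_error K loss \<alpha> x) \<le> (INF \<alpha>\<in>A. cond_error K loss \<alpha> x)"
      using False T(3) by (intro cINF_greatest) (auto simp: E_L)
  qed
  with C(1,2) show ?thesis by (rule that)
qed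

lemma borel_measurable_INF_cond_error:
  fixes K :: "'a \<Rightarrow> 'n::finite pmf"
  assumes "\<And>\<alpha> y. 0 \<le> loss \<alpha> y" and [measurable]: "\<And>y. (\<lambda>x. pmf (K x) y) \<in> borel_measurable M"
  shows "(\<lambda>x. INF \<alpha>\<in>A. cond_error K loss \<alpha> x) \<in> borel_measurable M"
proof -
  obtain C where "countable C"
    and eq: "\<And>x. (INF \<alpha>\<in>A. cond_error K loss \<alpha> x) = (INF \<alpha>\<in>C. cond_error K loss \<alpha> x)"
    using INF_cond_error_countable[of loss, OF assms(1)] by metis
  then show ?thesis
    unfolding eq unfolding cond_error_sum by (intro borel_measurable_cINF_real) measurable
qed

section \<open>Measurability of score vectors and of their conditional errors\<close>

lemma borel_measurable_score:
  assumes [measurable]: "h \<in> borel_measurable (X \<Otimes>\<^sub>M count_space UNIV)"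
  shows "score h \<in> borel_measurable X"
  unfolding score_def
proof (rule iffD2[OF borel_measurable_euclidean_space], rule ballI)
  fix b :: "real ^ 'b" assume "b \<in> Basis"
  then obtain i where b: "b = axis i 1"
    by (auto simp: Basis_vec_def)
  have "(\<lambda>x. h (x, i)) \<in> borel_measurable X"
    by measurable
  then show "(\<lambda>x. (\<chi> y. h (x, y)) \<bullet> b) \<in> borel_measurable X"
    by (simp add: b inner_axis)
qed

lemma borel_measurable_cond_error_score:
  assumes [measurable]: "\<And>y. (\<lambda>x. pmf (K x) y) \<in> borel_measurable X"
    and "h \<in> borel_measurable (X \<Otimes>\<^sub>M count_space UNIV)"
    and "(\<lambda>(\<alpha>, y). loss \<alpha> y) \<in> borel_measurable (borel \<Otimes>\<^sub>M count_space UNIV)"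
  shows "(\<lambda>x. cond_error K loss (score h x) x) \<in> borel_measurable X"
proof -
  have [measurable]: "(\<lambda>x. loss (score h x) y) \<in> borel_measurable X" for y
    using measurable_compose[OF measurable_Pair[OF borel_measurable_score[OF assms(2)]
        measurable_const[of y]] assms(3)] by simp
  show ?thesis
    unfolding cond_error_sum by measurable
qed

section \<open>Disintegration of \<open>D\<close> into its input marginal and the label
  kernel\<close>

lemma measurable_pair_count_space:
  fixes f :: "'a \<Rightarrow> 'b::countable \<Rightarrow> 'c"
  assumes "\<And>y. (\<lambda>x. f x y) \<in> measurable M N"
  shows "(\<lambda>(x, y). f x y) \<in> measurable (M \<Otimes>\<^sub>M count_space UNIV) N"
proof -
  have "(\<lambda>z. f (fst z) (snd z)) \<in> measurable (M \<Otimes>\<^sub>M count_space UNIV) N"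
    using measurable_compose[OF measurable_fst assms]
    by (rule measurable_compose_countable) (rule measurable_snd)
  then show ?thesis
    by (simp add: case_prod_beta')
qed

text \<open>A measurable set is the finite disjoint union of its slices
  \<open>S y \<times> {y}\<close>, and on such slices the kernel property prescribes
  \<open>D\<close>. Writing \<open>D\<close> as a density over a product makes Tonelli's theorem
  available.\<close>

lemma disintegration:
  fixes D :: "('a \<times> 'n::finite) measure"
  assumes D_sets: "sets D = sets (X \<Otimes>\<^sub>M count_space UNIV)"
    and K: "is_cond_label_dist X D K"
  shows "D = density (marginal X D \<Otimes>\<^sub>M count_space UNIV) (\<lambda>(x, y). ennreal (pmf (K x) y))"
proof (rule measure_eqI)
  let ?M = "marginal X D"
  have M_sets[measurable_cong]: "sets ?M = sets X"
    by (simp add: marginal_def)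
  have pair_sets: "sets (?M \<Otimes>\<^sub>M count_space (UNIV :: 'n set)) = sets (X \<Otimes>\<^sub>M count_space UNIV)"
    using M_sets refl by (rule sets_pair_measure_cong)
  have K_meas[measurable]: "(\<lambda>x. pmf (K x) y) \<in> borel_measurable X" for y
    using K by (simp add: is_cond_label_dist_def)
  show "sets D = sets (density (?M \<Otimes>\<^sub>M count_space UNIV) (\<lambda>(x, y). ennreal (pmf (K x) y)))"
    by (simp add: D_sets pair_sets)
  interpret C: sigma_finite_measure "count_space (UNIV :: 'n set)"
    by (rule sigma_finite_measure_count_space_finite) simp
  have dens[measurable]:
    "(\<lambda>(x, y). ennreal (pmf (K x) y)) \<in> borel_measurable (?M \<Otimes>\<^sub>M count_space UNIV)"
    by (rule measurable_pair_count_space) auto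
  fix E assume E: "E \<in> sets D"
  define S where "S y = (\<lambda>x. (x, y)) -` E" for y
  have E_X: "E \<in> sets (X \<Otimes>\<^sub>M count_space UNIV)" and [measurable]: "E \<in> sets (?M \<Otimes>\<^sub>M count_space UNIV)"
    using E by (simp_all add: D_sets pair_sets)
  have S[measurable]: "S y \<in> sets X" for y
    unfolding S_def by (rule sets_Pair2[OF E_X])
  have "E = (\<Union>y. S y \<times> {y})"
    by (auto simp: S_def)
  moreover have "(\<Sum>y\<in>UNIV. emeasure D (S y \<times> {y})) = emeasure D (\<Union>y. S y \<times> {y})"
    by (rule sum_emeasure) (auto simp: D_sets disjoint_family_on_def)
  ultimately have "emeasure D E = (\<Sum>y\<in>UNIV. emeasure D (S y \<times> {y}))"
    by simp
  also have "\<dots> = (\<Sum>y\<in>UNIV. (\<integral>\<^sup>+ x. ennreal (pmf (K x) y) * indicator (S y) x \<partial>?M))"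
    using K S by (simp add: is_cond_label_dist_def)
  also have "\<dots> = (\<integral>\<^sup>+ x. (\<Sum>y\<in>UNIV. ennreal (pmf (K x) y) * indicator (S y) x) \<partial>?M)"
    by (rule nn_integral_sum[symmetric]) measurable
  \<comment> \<open>The finite sum over labels is an integral against counting measure, and
    \<open>x\<close> lies in \<open>S y\<close> exactly when \<open>(x, y)\<close> lies in
    \<open>E\<close>.\<close>
  also have "\<dots> = (\<integral>\<^sup>+ x. \<integral>\<^sup>+ y. ennreal (pmf (K x) y) * indicator E (x, y)
      \<partial>count_space UNIV \<partial>?M)"
    by (simp add: nn_integral_count_space_finite S_def indicator_def)
  also have "\<dots> = (\<integral>\<^sup>+ z. (case z of (x, y) \<Rightarrow> ennreal (pmf (K x) y)) * indicator E z
      \<partial>(?M \<Otimes>\<^sub>M count_space UNIV))"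
    by (subst C.nn_integral_fst[symmetric]) (rule borel_measurable_times_ennreal[OF dens], simp_all)
  also have "\<dots> = emeasure (density (?M \<Otimes>\<^sub>M count_space UNIV) (\<lambda>(x, y). ennreal (pmf (K x) y))) E"
    by (rule emeasure_density[symmetric]) measurable
  finally show "emeasure D E =
      emeasure (density (?M \<Otimes>\<^sub>M count_space UNIV) (\<lambda>(x, y). ennreal (pmf (K x) y))) E" .
qed

text \<open>This is the tower property: the density form of \<open>D\<close> and Tonelli's theorem
  turn the expected loss into an iterated integral whose inner part is the conditional error.
  Nonnegativity of the loss covers infinite values too.\<close>

lemma gen_error_eq_cond_error:
  fixes D :: "('a \<times> 'n::finite) measure"
  assumes D_sets: "sets D = sets (X \<Otimes>\<^sub>M count_space UNIV)"
    and K: "is_cond_label_dist X D K"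
    and h: "h \<in> borel_measurable (X \<Otimes>\<^sub>M count_space UNIV)"
    and loss_nonneg: "\<And>\<alpha> y. 0 \<le> loss \<alpha> y"
    and loss: "(\<lambda>(\<alpha>, y). loss \<alpha> y) \<in> borel_measurable (borel \<Otimes>\<^sub>M count_space UNIV)"
  shows "gen_error D loss h = nn_expectation (marginal X D) (\<lambda>x. cond_error K loss (score h x) x)"
proof -
  let ?M = "marginal X D"
  let ?l = "\<lambda>(x, y). ennreal (loss (score h x) y)"
  have M_sets[measurable_cong]: "sets ?M = sets X"
    by (simp add: marginal_def)
  have K_meas[measurable]: "(\<lambda>x. pmf (K x) y) \<in> borel_measurable X" for y
    using K by (simp add: is_cond_label_dist_def)
  interpret C: sigma_finite_measure "count_space (UNIV :: 'n set)"
    by (rule sigma_finite_measure_count_space_finite) simp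
  have dens[measurable]:
    "(\<lambda>(x, y). ennreal (pmf (K x) y)) \<in> borel_measurable (?M \<Otimes>\<^sub>M count_space UNIV)"
    by (rule measurable_pair_count_space) auto
  have loss_y: "(\<lambda>x. loss (score h x) y) \<in> borel_measurable X" for y
    using measurable_compose[OF measurable_Pair[OF borel_measurable_score[OF h]
        measurable_const[of y]] loss] by simp
  have l[measurable]: "?l \<in> borel_measurable (?M \<Otimes>\<^sub>M count_space UNIV)"
    by (rule measurable_pair_count_space)
      (use measurable_compose[OF loss_y measurable_ennreal] in
        \<open>simp add: measurable_cong_sets[OF M_sets refl]\<close>)
  have "(\<integral>\<^sup>+ z. ennreal (case z of (x, y) \<Rightarrow> loss (score h x) y) \<partial>D) = (\<integral>\<^sup>+ z. ?l z \<partial>D)"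
    by (intro nn_integral_cong) auto
  also have "\<dots> = (\<integral>\<^sup>+ z. (case z of (x, y) \<Rightarrow> ennreal (pmf (K x) y)) * ?l z \<partial>(?M \<Otimes>\<^sub>M count_space UNIV))"
    by (subst disintegration[OF D_sets K]) (rule nn_integral_density[OF dens l])
  also have "\<dots> = (\<integral>\<^sup>+ x. \<integral>\<^sup>+ y. ennreal (pmf (K x) y) * ennreal (loss (score h x) y)
      \<partial>count_space UNIV \<partial>?M)"
    by (subst C.nn_integral_fst[symmetric]) (rule borel_measurable_times_ennreal[OF dens l], simp)
  also have "\<dots> = (\<integral>\<^sup>+ x. ennreal (cond_error K loss (score h x) x) \<partial>?M)"
    by (simp add: nn_integral_count_space_finite cond_error_sum loss_nonneg sum_ennreal[symmetric]
        ennreal_mult mult.commute del: sum_ennreal)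
  finally show ?thesis
    by (simp add: gen_error_def nn_expectation_def)
qed

text \<open>Finiteness in \<open>gap_defined\<close> lets the subtraction in the gap be undone. The
  third part leaves out a gap equal to \<open>\<epsilon>\<close> that is not attained, since then
  every \<open>h\<close> in \<open>H\<close> has expected excess strictly above
  \<open>\<epsilon>\<close>.\<close>

theorem theorem19:
  fixes X :: "'a measure"
    and D :: "('a \<times> 'n::finite) measure"
    and K :: "'a \<Rightarrow> 'n pmf"
    and H :: "('a \<times> 'n \<Rightarrow> real) set"
    and loss :: "real ^ 'n \<Rightarrow> 'n \<Rightarrow> real"
    and A :: "(real ^ 'n) set"
  assumes D_prob: "prob_space D"
    and D_sets: "sets D = sets (X \<Otimes>\<^sub>M count_space UNIV)"
    and K_cond: "is_cond_label_dist X D K"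
    and H_meas: "\<And>h. h \<in> H \<Longrightarrow> h \<in> borel_measurable (X \<Otimes>\<^sub>M count_space UNIV)"
    and loss_nonneg: "\<And>\<alpha> y. 0 \<le> loss \<alpha> y"
    and loss_meas: "(\<lambda>(\<alpha>, y). loss \<alpha> y) \<in> borel_measurable (borel \<Otimes>\<^sub>M count_space UNIV)"
    and A_indep: "\<And>x. x \<in> space X \<Longrightarrow> {score h x | h. h \<in> H} = A"
    and gap_defined:
      "nn_expectation (marginal X D) (\<lambda>x. INF h\<in>H. cond_error K loss (score h x) x) < \<infinity>"
  shows "(best_in_class_achieved D loss H \<and> minimizability_gap X D K loss H = 0 \<longleftrightarrow>
      (\<exists>h\<in>H. AE x in marginal X D.
         cond_error K loss (score h x) x = (INF \<alpha>\<in>A. cond_error K loss \<alpha> x))) \<and>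
    (\<forall>\<alpha>_star :: 'a \<Rightarrow> real ^ 'n.
      (AE x in marginal X D. inj_on (\<lambda>\<alpha>. cond_error K loss \<alpha> x) A) \<and>
      (AE x in marginal X D. \<alpha>_star x \<in> A \<and>
         (INF \<alpha>\<in>A. cond_error K loss \<alpha> x) = cond_error K loss (\<alpha>_star x) x) \<longrightarrow>
      (\<forall>h\<in>H.
         (AE x in marginal X D.
            cond_error K loss (score h x) x = (INF \<alpha>\<in>A. cond_error K loss \<alpha> x)) \<longleftrightarrow>
         (AE x in marginal X D. score h x = \<alpha>_star x))) \<and>
    (\<forall>\<epsilon> :: real.
      best_in_class_achieved D loss H \<or> minimizability_gap X D K loss H \<noteq> ereal \<epsilon> \<longrightarrow>
      (minimizability_gap X D K loss H \<le> ereal \<epsilon> \<longleftrightarrow>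
         (\<exists>h\<in>H. nn_expectation (marginal X D)
            (\<lambda>x. cond_error K loss (score h x) x - (INF \<alpha>\<in>A. cond_error K loss \<alpha> x)) \<le> ereal \<epsilon>)))"
proof -
  let ?M = "marginal X D"
  let ?m = "\<lambda>x. INF \<alpha>\<in>A. cond_error K loss \<alpha> x"
  \<comment> \<open>Everything reduces to three extended reals: the expected pointwise infimum
    \<open>F\<close>, the expected excess \<open>e h\<close> of a hypothesis, and the gap
    \<open>G\<close>.\<close>
  define F where "F = nn_expectation ?M ?m"
  define e where "e h = nn_expectation ?M (\<lambda>x. cond_error K loss (score h x) x - ?m x)" for h
  define G where "G = minimizability_gap X D K loss H"
  have M_sets[measurable_cong]: "sets ?M = sets X" and M_space: "space ?M = space X"
    by (simp_all add: marginal_def)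
  have K_meas: "(\<lambda>x. pmf (K x) y) \<in> borel_measurable X" for y
    using K_cond by (simp add: is_cond_label_dist_def)
  have m_meas[measurable]: "?m \<in> borel_measurable X"
    using loss_nonneg K_meas by (rule borel_measurable_INF_cond_error)
  have c_meas[measurable]: "(\<lambda>x. cond_error K loss (score h x) x) \<in> borel_measurable X" if "h \<in> H" for h
    using K_meas H_meas[OF that] loss_meas by (rule borel_measurable_cond_error_score)
  have score_A: "score h x \<in> A" if "h \<in> H" "x \<in> space ?M" for h x
    using A_indep[of x] that M_space by auto
  have m_le: "?m x \<le> cond_error K loss (score h x) x" if "h \<in> H" "x \<in> space ?M" for h x
    using score_A[OF that] bdd_below_cond_error[of loss, OF loss_nonneg] by (intro cINF_lower) auto
  \<comment> \<open>The member \<open>h\<close> witnesses that \<open>A\<close> is nonempty; a real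
    infimum over the empty set would be an unspecified value.\<close>
  have m_nonneg: "0 \<le> ?m x" if "h \<in> H" "x \<in> space ?M" for h x
    using score_A[OF that] cond_error_nonneg[of loss, OF loss_nonneg]
    by (intro cINF_greatest) auto
  have F_H: "nn_expectation ?M (\<lambda>x. INF h\<in>H. cond_error K loss (score h x) x) = F"
    unfolding F_def
  proof (rule nn_expectation_cong)
    fix x assume "x \<in> space ?M"
    then have "A = (\<lambda>h. score h x) ` H"
      using A_indep[of x] M_space by auto
    then show "(INF h\<in>H. cond_error K loss (score h x) x) = ?m x"
      by (simp add: image_comp comp_def)
  qed
  have F_fin: "\<bar>F\<bar> \<noteq> \<infinity>"
    using gap_defined nn_expectation_nonneg[of ?M ?m] unfolding F_H F_def[symmetric] by auto
  have gen: "gen_error D loss h = F + e h" if "h \<in> H" for h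
  proof -
    \<comment> \<open>Infimum and excess are both nonnegative, so the expectation splits even if
      \<open>e h\<close> is infinite.\<close>
    have "gen_error D loss h = nn_expectation ?M (\<lambda>x. ?m x + (cond_error K loss (score h x) x - ?m x))"
      using gen_error_eq_cond_error[OF D_sets K_cond H_meas[OF that] loss_nonneg loss_meas] by simp
    also have "\<dots> = F + e h"
      unfolding F_def e_def using that m_le m_nonneg
      by (intro nn_expectation_add) (auto simp: M_sets cong: measurable_cong_sets)
    finally show ?thesis .
  qed
  have e_nonneg: "0 \<le> e h" for h
    by (simp add: e_def nn_expectation_nonneg)
  have e_0: "e h = 0 \<longleftrightarrow> (AE x in ?M. cond_error K loss (score h x) x = ?m x)" if "h \<in> H" for h
    unfolding e_def using that m_le
    by (subst nn_expectation_eq_0_iff) (auto simp: M_sets cong: measurable_cong_sets)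
  have best: "best_in_class_error D loss H = F + G"
    unfolding G_def minimizability_gap_def F_H using F_fin
    by (cases F; cases "best_in_class_error D loss H") auto
  have G_eq: "G = (INF h\<in>H. e h)"
  proof (cases "H = {}")
    \<comment> \<open>With no hypotheses the best-in-class error is infinite; subtracting the finite
      \<open>F\<close> leaves infinity, which is also the empty infimum of \<open>e\<close>.\<close>
    case True
    then show ?thesis
      using F_fin unfolding G_def minimizability_gap_def F_H best_in_class_error_def
      by (auto simp: top_ereal_def)
  next
    case False
    have "F + G = (INF h\<in>H. F + e h)"
      using best gen by (simp add: best_in_class_error_def)
    also have "\<dots> = F + (INF h\<in>H. e h)"
      using False F_fin e_nonneg by (intro INF_ereal_add_right) auto
    finally show ?thesis
      using F_fin by (cases F; cases G; cases "INF h\<in>H. e h") auto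
  qed
  have achieved: "best_in_class_achieved D loss H \<longleftrightarrow> (\<exists>h\<in>H. e h = G)"
  proof -
    have "F + e h = F + G \<longleftrightarrow> e h = G" for h
      using F_fin by (cases F; cases G; cases "e h") auto
    then show ?thesis
      unfolding best_in_class_achieved_def best using gen by auto
  qed
  have G_le: "G \<le> e h" if "h \<in> H" for h
    unfolding G_eq using that by (rule INF_lower)
  have G_nonneg: "0 \<le> G"
    unfolding G_eq using e_nonneg by (intro INF_greatest)
  \<comment> \<open>Attainment with \<open>G = 0\<close> gives \<open>e h = 0\<close>; conversely
    \<open>e h = 0\<close> squeezes \<open>G\<close> between 0 and \<open>e h\<close>, so the same
    \<open>h\<close> attains it.\<close>
  have part1: "best_in_class_achieved D loss H \<and> G = 0 \<longleftrightarrow>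
      (\<exists>h\<in>H. AE x in ?M. cond_error K loss (score h x) x = ?m x)"
  proof -
    have "best_in_class_achieved D loss H \<and> G = 0 \<longleftrightarrow> (\<exists>h\<in>H. e h = 0)"
      unfolding achieved using G_le G_nonneg by (metis antisym)
    then show ?thesis
      using e_0 by auto
  qed
  have part2: "(AE x in ?M. cond_error K loss (score h x) x = ?m x) \<longleftrightarrow>
      (AE x in ?M. score h x = \<alpha>_star x)"
    if inj: "AE x in ?M. inj_on (\<lambda>\<alpha>. cond_error K loss \<alpha> x) A"
      and star: "AE x in ?M. \<alpha>_star x \<in> A \<and> ?m x = cond_error K loss (\<alpha>_star x) x"
      and h: "h \<in> H" for \<alpha>_star h
  proof -
    \<comment> \<open>Both \<open>score h x\<close> and \<open>\<alpha>_star x\<close> lie in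
      \<open>A\<close>, so injectivity there turns equal conditional errors into equal
      vectors.\<close>
    have "AE x in ?M. cond_error K loss (score h x) x = ?m x \<longleftrightarrow> score h x = \<alpha>_star x"
      using inj star AE_space
    proof eventually_elim
      case (elim x)
      then show ?case
        using score_A[OF h] by (auto dest: inj_onD)
    qed
    then show ?thesis
      by (rule eventually_subst)
  qed
  have part3: "G \<le> ereal \<epsilon> \<longleftrightarrow> (\<exists>h\<in>H. e h \<le> ereal \<epsilon>)"
    if "best_in_class_achieved D loss H \<or> G \<noteq> ereal \<epsilon>" for \<epsilon>
  proof
    assume le: "G \<le> ereal \<epsilon>"
    from that show "\<exists>h\<in>H. e h \<le> ereal \<epsilon>"
    proof
      assume "best_in_class_achieved D loss H"
      then show ?thesis
        using le achieved by auto
    next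
      \<comment> \<open>A strict inequality for the infimum already yields a hypothesis below
        \<open>\<epsilon>\<close>, attained or not.\<close>
      assume "G \<noteq> ereal \<epsilon>"
      with le have "(INF h\<in>H. e h) < ereal \<epsilon>"
        by (simp add: G_eq)
      then show ?thesis
        unfolding INF_less_iff by (auto intro: less_imp_le)
    qed
  next
    assume "\<exists>h\<in>H. e h \<le> ereal \<epsilon>"
    then show "G \<le> ereal \<epsilon>"
      using G_le order_trans by blast
  qed
  show ?thesis
    using part1 part2 part3 unfolding G_def e_def by blast
qed

end
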